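(* Let $(G,p)$ be a proper isostatic framework in $\mathbb{R}^d$. Then: (i) for each proper subframework $(X,p)$ and each spatial symmetry $g$ of $(X,p)$, $$\bigl|\operatorname{trace}(g)\,v_X^g-e_X^g-\operatorname{trace}(\rho_{rig}(g))\bigr|\le d\,v_X-e_X-\tfrac{d(d+1)}{2},$$ where $v_X$ and $e_X$ are the numbers of vertices and edges of $X$, and $v_X^g$ (resp. $e_X^g$) is the number of vertices (resp. edges) of $X$ that are unmoved by the symmetry $g$. (ii) For planar frameworks ($d=2$) a necessary condition for isostaticity is that for each reflection symmetry $g$ of a subframework $(X,p)$, $$|-e_X^g+1|\le 2v_X-e_X-3.$$
   Context: A framework $(G,p)$ in $\mathbb{R}^d$ is a finite connected simple graph $G=(V,E)$ with vertices $v_1,\dots,v_n$ and a vector $p=(p_1,\dots,p_n)$ of points of $\mathbb{R}^d$. It is called proper if the framework points are distinct and do not all lie in a hyperplane of $\mathbb{R}^d$. The rigidity matrix $R(G,p)$ is the $|E|\times d|V|$ matrix whose row for the edge $(v_i,v_j)$ has $p_i-p_j$ in the $d$ columns of $v_i$, $p_j-p_i$ in the $d$ columns of $v_j$, and zeros elsewhere. $(G,p)$ is isostatic if $\operatorname{rank}R(G,p)=d|V|-\frac{d(d+1)}{2}=|E|$. A subframework $(X,p)$ is given by a subgraph $X$ of $G$ with at least one edge, with the framework points being those $p_i$ with $v_i$ a vertex of $X$. It is proper if its framework points are not all contained in a hyperplane. A spatial symmetry $g$ of $(X,p)$ is an automorphism $\sigma$ of $X$ together with an isometry $T$ of $\mathbb{R}^d$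 with $p_{\sigma(i)}=Tp_i$ for all vertices $v_i$ of $X$; $\rho_{sp}(g)\in O(d)$ is the linear part of $T$ and $\operatorname{trace}(g)=\operatorname{trace}(\rho_{sp}(g))$. It is a reflection symmetry if $T$ is a reflection in a hyperplane (in a line if $d=2$). A vertex or edge of $X$ is unmoved by $g$ if it is fixed by $\sigma$ (an edge as an unordered pair). $\rho_{rig}(g)$ is the restriction of the linear map $\hat\rho_v(g)$, given by $(\hat\rho_v(g)u)_{\sigma(i)}=\rho_{sp}(g)u_i$ for families $u=(u_i)$, $u_i\in\mathbb{R}^d$, indexed by the vertices of $X$, to the invariant space of trivial infinitesimal flexes $\{(Ap_i+b)_i: A \text{ skew-symmetric } d\times d,\ b\in\mathbb{R}^d\}$. *)

theory Defs
  imports "HOL-Analysis.Analysis"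
begin

definition simple_graph :: "'v set \<Rightarrow> 'v set set \<Rightarrow> bool" where
  "simple_graph V E \<longleftrightarrow> finite V \<and> (\<forall>e\<in>E. e \<subseteq> V \<and> card e = 2)"

definition connected_graph :: "'v set \<Rightarrow> 'v set set \<Rightarrow> bool" where
  "connected_graph V E \<longleftrightarrow> (\<forall>u\<in>V. \<forall>v\<in>V. (u, v) \<in> {(x, y). {x, y} \<in> E}\<^sup>*)"

text \<open>The vertices of the graph \<open>G\<close> of a framework are all the elements of a finite type
  \<open>'v\<close>, so that \<open>G\<close> is given by its edge set alone; subgraphs of \<open>G\<close> have an explicit
  vertex set.\<close>

definition framework :: "'v::finite set set \<Rightarrow> ('v \<Rightarrow> real^'d) \<Rightarrow> bool" where
  "framework E p \<longleftrightarrow> simple_graph UNIV E \<and> connected_graph UNIV E"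

definition in_hyperplane :: "(real^'d) set \<Rightarrow> bool" where
  "in_hyperplane S \<longleftrightarrow> (\<exists>a b. a \<noteq> 0 \<and> S \<subseteq> {x. a \<bullet> x = b})"

definition proper_framework :: "'v::finite set set \<Rightarrow> ('v \<Rightarrow> real^'d) \<Rightarrow> bool" where
  "proper_framework E p \<longleftrightarrow> framework E p \<and> inj p \<and> \<not> in_hyperplane (range p)"

text \<open>Rows are indexed by all subsets of the vertex type, so the \<open>|E| \<times> d|V|\<close> rigidity matrix
  is padded with zero rows, which do not affect the rank. For an edge \<open>e\<close> containing \<open>v\<close>,
  \<open>the_elem (e - {v})\<close> is the other end of \<open>e\<close>.\<close>

definition rigidity_matrix :: "'v::finite set set \<Rightarrow> ('v \<Rightarrow> real^'d) \<Rightarrow> real^('v \<times> 'd)^('v set)" where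
  "rigidity_matrix E p =
     (\<chi> e c. case c of (v, k) \<Rightarrow>
        if e \<in> E \<and> v \<in> e then (p v - p (the_elem (e - {v}))) $ k else 0)"

definition isostatic :: "'v::finite set set \<Rightarrow> ('v \<Rightarrow> real^'d) \<Rightarrow> bool" where
  "isostatic E p \<longleftrightarrow>
     real (rank (rigidity_matrix E p)) =
       real (CARD('d) * CARD('v)) - real (CARD('d) * (CARD('d) + 1)) / 2 \<and>
     rank (rigidity_matrix E p) = card E"

definition subframework :: "'v::finite set set \<Rightarrow> 'v set \<Rightarrow> 'v set set \<Rightarrow> bool" where
  "subframework E V\<^sub>X E\<^sub>X \<longleftrightarrow> simple_graph V\<^sub>X E\<^sub>X \<and> E\<^sub>X \<subseteq> E \<and> E\<^sub>X \<noteq> {}"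

definition proper_subframework ::
    "'v::finite set set \<Rightarrow> ('v \<Rightarrow> real^'d) \<Rightarrow> 'v set \<Rightarrow> 'v set set \<Rightarrow> bool" where
  "proper_subframework E p V\<^sub>X E\<^sub>X \<longleftrightarrow> subframework E V\<^sub>X E\<^sub>X \<and> \<not> in_hyperplane (p ` V\<^sub>X)"

definition graph_automorphism :: "'v set \<Rightarrow> 'v set set \<Rightarrow> ('v \<Rightarrow> 'v) \<Rightarrow> bool" where
  "graph_automorphism V E \<sigma> \<longleftrightarrow>
     bij_betw \<sigma> V V \<and> (\<forall>u\<in>V. \<forall>v\<in>V. {u, v} \<in> E \<longleftrightarrow> {\<sigma> u, \<sigma> v} \<in> E)"

definition spatial_symmetry ::
    "'v set \<Rightarrow> 'v set set \<Rightarrow> ('v \<Rightarrow> real^'d) \<Rightarrow> ('v \<Rightarrow> 'v) \<Rightarrow> (real^'d \<Rightarrow> real^'d) \<Rightarrow> bool" where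
  "spatial_symmetry V E p \<sigma> T \<longleftrightarrow>
     graph_automorphism V E \<sigma> \<and> (\<forall>x y. dist (T x) (T y) = dist x y) \<and>
     (\<forall>v\<in>V. p (\<sigma> v) = T (p v))"

definition hyperplane_reflection :: "(real^'d \<Rightarrow> real^'d) \<Rightarrow> bool" where
  "hyperplane_reflection T \<longleftrightarrow>
     (\<exists>a b. a \<noteq> 0 \<and> (\<forall>x. T x = x - (2 * (a \<bullet> x - b) / (a \<bullet> a)) *\<^sub>R a))"

definition reflection_symmetry ::
    "'v set \<Rightarrow> 'v set set \<Rightarrow> ('v \<Rightarrow> real^'d) \<Rightarrow> ('v \<Rightarrow> 'v) \<Rightarrow> (real^'d \<Rightarrow> real^'d) \<Rightarrow> bool" where
  "reflection_symmetry V E p \<sigma> T \<longleftrightarrow> spatial_symmetry V E p \<sigma> T \<and> hyperplane_reflection T"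

definition rho_sp :: "(real^'d \<Rightarrow> real^'d) \<Rightarrow> real^'d \<Rightarrow> real^'d" where
  "rho_sp T x = T x - T 0"

definition trace_sp :: "(real^'d \<Rightarrow> real^'d) \<Rightarrow> real" where
  "trace_sp T = trace (matrix (rho_sp T))"

definition unmoved_vertices :: "'v set \<Rightarrow> ('v \<Rightarrow> 'v) \<Rightarrow> 'v set" where
  "unmoved_vertices V \<sigma> = {v \<in> V. \<sigma> v = v}"

definition unmoved_edges :: "'v set set \<Rightarrow> ('v \<Rightarrow> 'v) \<Rightarrow> 'v set set" where
  "unmoved_edges E \<sigma> = {e \<in> E. \<sigma> ` e = e}"

text \<open>Families in \<open>\<real>\<^sup>d\<close> indexed by a set \<open>V\<close> of vertices are represented by the elements of
  \<open>(real^'d)^'v\<close> that vanish outside \<open>V\<close>.\<close>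

definition rho_v ::
    "'v::finite set \<Rightarrow> ('v \<Rightarrow> 'v) \<Rightarrow> (real^'d \<Rightarrow> real^'d) \<Rightarrow> (real^'d)^'v \<Rightarrow> (real^'d)^'v" where
  "rho_v V \<sigma> T u = (\<chi> j. if j \<in> V then rho_sp T (u $ inv_into V \<sigma> j) else 0)"

definition trivial_flexes :: "'v::finite set \<Rightarrow> ('v \<Rightarrow> real^'d) \<Rightarrow> ((real^'d)^'v) set" where
  "trivial_flexes V p =
     {(\<chi> i. if i \<in> V then A *v p i + b else 0) | (A :: real^'d^'d) b. transpose A = - A}"

text \<open>The trace of the restriction of \<open>f\<close> to an \<open>f\<close>-invariant finite-dimensional subspace \<open>W\<close>:
  the sum of the diagonal entries of its matrix with respect to a basis of \<open>W\<close>. It does not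
  depend on the basis.\<close>

definition trace_on :: "'a::real_vector set \<Rightarrow> ('a \<Rightarrow> 'a) \<Rightarrow> real" where
  "trace_on W f =
     (let B = (SOME B. independent B \<and> span B = W) in \<Sum>b\<in>B. representation B (f b) b)"

definition trace_rig ::
    "'v::finite set \<Rightarrow> ('v \<Rightarrow> real^'d) \<Rightarrow> ('v \<Rightarrow> 'v) \<Rightarrow> (real^'d \<Rightarrow> real^'d) \<Rightarrow> real" where
  "trace_rig V p \<sigma> T = trace_on (trivial_flexes V p) (rho_v V \<sigma> T)"

end

theory Submission
  imports Defs
begin

text \<open>
  Let \<open>W\<close> be the space of families of vectors of \<open>\<real>\<^sup>d\<close> indexed by the vertices of a subframework
  \<open>X\<close>, and let \<open>f\<close> be the action of a spatial symmetry \<open>g\<close> on \<open>W\<close>. It permutes the components and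
  applies an orthogonal map to each of them, so it is an isometry of \<open>W\<close>. Three pairwise
  orthogonal subspaces with sum \<open>W\<close> are invariant under \<open>f\<close>.

  \<^item> The span of the rows of the rigidity matrix that belong to the edges of \<open>X\<close>. By isostaticity
    these rows are linearly independent (\<open>isostatic_rows\<close>), and \<open>f\<close> permutes them as \<open>g\<close>
    permutes the edges (\<open>rho_v_edge_row\<close>). The dimension is the number of edges, and the trace of
    \<open>f\<close> is the number of unmoved edges.

  \<^item> The space of trivial flexes, which is orthogonal to the rows because rigid motions preserve
    lengths. The trace of \<open>f\<close> is the trace of \<open>\<rho>\<^sub>r\<^sub>i\<^sub>g(g)\<close> by definition. The dimension is
    \<open>d(d+1)/2\<close> if the points of \<open>X\<close> do not lie in a hyperplane (\<open>flex_determining_if_not_in_hyperplane\<close>,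
    \<open>dim_trivial_flexes\<close>).

  \<^item> The orthogonal complement of both in \<open>W\<close>, on which \<open>f\<close> is still an isometry.

  On \<open>W\<close> itself the trace is \<open>trace(g)\<close> times the number of unmoved vertices. By additivity
  of the trace, the expression inside the absolute value of (i) is the trace of \<open>f\<close> on the third
  space, and the right-hand side is the dimension of that space. The trace of an isometry is bounded
  by the dimension in absolute value, which gives (i) (\<open>symmetric_count\<close>).

  For (ii), a plane reflection has trace 0, and its action on the trivial flexes has trace \<open>-1\<close>
  (\<open>trace_rig_plane_reflection\<close>). The two ends of an edge are distinct points, and in the plane two
  distinct points suffice for the trivial flexes to have dimension 3, so the argument for (i) also
  applies to subframeworks on a line.
\<close>

section \<open>Traces of linear maps on invariant subspaces\<close>

text \<open>The usual proof that the trace does not depend on the basis: both traces are the sum over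
  \<open>b \<in> B\<close> and \<open>c \<in> C\<close> of \<open>representation C b c * representation B (f c) b\<close>, where \<open>C\<close> is the
  basis chosen in the definition of \<^const>\<open>trace_on\<close>.\<close>
lemma trace_on_eq_sum_representation:
  fixes f :: "'a::euclidean_space \<Rightarrow> 'a"
  assumes f: "linear f" and inv: "f ` W \<subseteq> W" and B: "independent B" "span B = W"
  shows "trace_on W f = (\<Sum>b\<in>B. representation B (f b) b)"
proof -
  define C where "C = (SOME C. independent C \<and> span C = W)"
  have "independent C \<and> span C = W"
    unfolding C_def by (rule someI[of _ B]) (use B in simp)
  then have C: "independent C" "span C = W" by auto
  have fin: "finite B" "finite C"
    using B(1) C(1) independent_imp_finite by blast+
  have sub: "B \<subseteq> W" "C \<subseteq> W"
    using B(2) C(2) span_superset by blast+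
  have repr: "(\<Sum>c\<in>C. representation C x c *\<^sub>R c) = x" "(\<Sum>b\<in>B. representation B x b *\<^sub>R b) = x"
    if "x \<in> W" for x
    using that fin B C by (auto intro!: real_vector.sum_representation_eq)
  have "(\<Sum>b\<in>B. representation B (f b) b) =
      (\<Sum>b\<in>B. \<Sum>c\<in>C. representation C b c * representation B (f c) b)"
  proof (rule sum.cong[OF refl])
    fix b assume "b \<in> B"
    then have "f b = f (\<Sum>c\<in>C. representation C b c *\<^sub>R c)"
      using repr sub by auto
    also have "\<dots> = (\<Sum>c\<in>C. representation C b c *\<^sub>R f c)"
      by (simp add: linear_sum[OF f] linear_scale[OF f])
    finally have fb: "f b = (\<Sum>c\<in>C. representation C b c *\<^sub>R f c)" .
    have mem: "f c \<in> span B" if "c \<in> C" for c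
      using that inv sub B(2) by auto
    show "representation B (f b) b = (\<Sum>c\<in>C. representation C b c * representation B (f c) b)"
      unfolding fb using mem B(1)
      by (simp add: real_vector.representation_sum real_vector.representation_scale span_mul)
  qed
  also have "\<dots> = (\<Sum>c\<in>C. \<Sum>b\<in>B. representation B (f c) b * representation C b c)"
    by (subst sum.swap) (simp add: mult.commute)
  also have "\<dots> = (\<Sum>c\<in>C. representation C (f c) c)"
  proof (rule sum.cong[OF refl])
    fix c assume "c \<in> C"
    then have "f c \<in> W" using inv sub by auto
    have mem: "b \<in> span C" if "b \<in> B" for b
      using that sub C(2) by auto
    have "representation C (f c) c = representation C (\<Sum>b\<in>B. representation B (f c) b *\<^sub>R b) c"
      using repr(2)[OF \<open>f c \<in> W\<close>] by simp
    also have "\<dots> = (\<Sum>b\<in>B. representation B (f c) b * representation C b c)"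
      using mem C(1)
      by (simp add: real_vector.representation_sum real_vector.representation_scale span_mul)
    finally show "(\<Sum>b\<in>B. representation B (f c) b * representation C b c) = representation C (f c) c"
      by simp
  qed
  finally show ?thesis
    unfolding trace_on_def Let_def C_def[symmetric] by simp
qed

lemma trace_on_orthonormal:
  fixes f :: "'a::euclidean_space \<Rightarrow> 'a"
  assumes f: "linear f" and inv: "f ` W \<subseteq> W"
    and B: "pairwise orthogonal B" "\<And>b. b \<in> B \<Longrightarrow> norm b = 1" "span B = W"
  shows "trace_on W f = (\<Sum>b\<in>B. f b \<bullet> b)"
proof -
  have ind: "independent B"
    using B(1) by (rule pairwise_orthogonal_independent) (use B(2) in force)
  then have fin: "finite B" by (rule independent_imp_finite)
  have "representation B (f b) b = f b \<bullet> b" if b: "b \<in> B" for b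
  proof -
    have "f b \<in> span B" using inv b B(3) span_superset by blast
    then have "f b \<bullet> b = (\<Sum>c\<in>B. representation B (f b) c *\<^sub>R c) \<bullet> b"
      using real_vector.sum_representation_eq[OF ind _ fin, of "f b"] by simp
    also have "\<dots> = (\<Sum>c\<in>B. if c = b then representation B (f b) b else 0)"
      unfolding inner_sum_left
    proof (rule sum.cong[OF refl])
      fix c assume "c \<in> B"
      then show "(representation B (f b) c *\<^sub>R c) \<bullet> b = (if c = b then representation B (f b) b else 0)"
        using B(1,2) b by (auto simp: pairwise_def orthogonal_def dot_square_norm)
    qed
    also have "\<dots> = representation B (f b) b" using fin b by simp
    finally show ?thesis by simp
  qed
  then show ?thesis
    using trace_on_eq_sum_representation[OF f inv ind B(3)] by simp
qed


lemma trace_on_coordinate_subspace: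
  fixes f :: "'a::euclidean_space \<Rightarrow> 'a"
  assumes "linear f" "f ` W \<subseteq> W" "B \<subseteq> Basis" "span B = W"
  shows "trace_on W f = (\<Sum>b\<in>B. f b \<bullet> b)"
proof (rule trace_on_orthonormal)
  show "pairwise orthogonal B"
    using assms(3) by (auto simp: pairwise_def orthogonal_def inner_not_same_Basis subset_iff)
qed (use assms in \<open>auto intro: norm_Basis\<close>)

lemma trace_on_eigenbasis:
  fixes f :: "'a::euclidean_space \<Rightarrow> 'a"
  assumes f: "linear f" and B: "independent B" "span B = W"
    and eig: "\<And>b. b \<in> B \<Longrightarrow> f b = l b *\<^sub>R b"
  shows "trace_on W f = (\<Sum>b\<in>B. l b)"
proof -
  have "f ` W \<subseteq> W"
  proof -
    have "f ` B \<subseteq> span B" using eig by (auto intro: span_mul span_base)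
    then have "span (f ` B) \<subseteq> span B" by (simp add: span_minimal)
    then show ?thesis using B(2) by (simp add: linear_span_image[OF f])
  qed
  then have "trace_on W f = (\<Sum>b\<in>B. representation B (f b) b)"
    using trace_on_eq_sum_representation f B by blast
  also have "\<dots> = (\<Sum>b\<in>B. l b)"
    using B(1) eig
    by (intro sum.cong refl) (simp add: real_vector.representation_scale span_base real_vector.representation_basis)
  finally show ?thesis .
qed

text \<open>A permuted basis vector contributes to the diagonal only if it is fixed, so the trace of a
  permutation representation counts fixed points.\<close>
lemma trace_on_permuted_basis:
  fixes f :: "'a::euclidean_space \<Rightarrow> 'a"
  assumes f: "linear f" and B: "independent B" "span B = W" and perm: "f ` B \<subseteq> B"
  shows "trace_on W f = real (card {b \<in> B. f b = b})"
proof -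
  have "f ` W \<subseteq> W"
    using B(2) perm by (metis linear_span_image[OF f] span_mono)
  then have "trace_on W f = (\<Sum>b\<in>B. representation B (f b) b)"
    using trace_on_eq_sum_representation f B by blast
  also have "\<dots> = (\<Sum>b\<in>B. if f b = b then 1 else 0)"
    using B(1) perm by (intro sum.cong refl) (auto simp: real_vector.representation_basis)
  also have "\<dots> = real (card {b \<in> B. f b = b})"
    using independent_imp_finite[OF B(1)] by (simp add: sum.If_cases Int_def)
  finally show ?thesis .
qed

definition isometric_on :: "'a::real_inner set \<Rightarrow> ('a \<Rightarrow> 'a) \<Rightarrow> bool" where
  "isometric_on W f \<longleftrightarrow> linear f \<and> f ` W \<subseteq> W \<and> (\<forall>x\<in>W. \<forall>y\<in>W. f x \<bullet> f y = x \<bullet> y)"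

definition complement_in :: "'a::real_inner set \<Rightarrow> 'a set \<Rightarrow> 'a set" where
  "complement_in W U = {y \<in> W. \<forall>x\<in>U. orthogonal x y}"

lemma subspace_complement_in:
  assumes "subspace W"
  shows "subspace (complement_in W U)"
  using assms unfolding complement_in_def subspace_def
  by (auto simp: orthogonal_def inner_right_distrib)

text \<open>In an orthonormal basis each diagonal entry \<open>f b \<bullet> b\<close> is at most 1 in absolute value, by the
  Cauchy-Schwarz inequality. All inequalities of this development come from this bound.\<close>
lemma abs_trace_on_isometric_le_dim:
  fixes f :: "'a::euclidean_space \<Rightarrow> 'a"
  assumes "isometric_on W f" "subspace W"
  shows "\<bar>trace_on W f\<bar> \<le> real (dim W)"
proof -
  obtain B where B: "B \<subseteq> W" "pairwise orthogonal B" "\<And>b. b \<in> B \<Longrightarrow> norm b = 1"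
    "independent B" "card B = dim W" "span B = W"
    using orthonormal_basis_subspace[OF assms(2)] by blast
  have "\<bar>trace_on W f\<bar> = \<bar>\<Sum>b\<in>B. f b \<bullet> b\<bar>"
    using trace_on_orthonormal B assms(1) unfolding isometric_on_def by metis
  also have "\<dots> \<le> (\<Sum>b\<in>B. 1)"
  proof (rule order_trans[OF sum_abs sum_mono])
    fix b assume b: "b \<in> B"
    then have "norm (f b) = norm b"
      using B(1) assms(1) unfolding isometric_on_def by (auto simp: norm_eq_sqrt_inner)
    then show "\<bar>f b \<bullet> b\<bar> \<le> 1"
      using Cauchy_Schwarz_ineq2[of "f b" b] B(3)[OF b] by simp
  qed
  finally show ?thesis using B(5) by simp
qed

text \<open>An isometry maps the invariant subspace \<open>U\<close> onto itself by finite dimension. Therefore a vector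
  orthogonal to \<open>U\<close> is sent to a vector orthogonal to \<open>f ` U = U\<close>.\<close>
lemma isometric_on_complement:
  fixes f :: "'a::euclidean_space \<Rightarrow> 'a"
  assumes iso: "isometric_on W f" and U: "subspace U" "U \<subseteq> W" "f ` U \<subseteq> U"
  shows "isometric_on (complement_in W U) f"
proof -
  from iso have f: "linear f" and W: "f ` W \<subseteq> W"
    and inner: "\<And>x y. x \<in> W \<Longrightarrow> y \<in> W \<Longrightarrow> f x \<bullet> f y = x \<bullet> y"
    by (auto simp: isometric_on_def)
  have "inj_on f U"
  proof (rule inj_onI)
    fix x y assume xy: "x \<in> U" "y \<in> U" "f x = f y"
    then have d: "x - y \<in> W" using U by (auto simp: subspace_diff subset_iff)
    have "(x - y) \<bullet> (x - y) = f (x - y) \<bullet> f (x - y)" using inner[OF d d] by simp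
    also have "\<dots> = 0" using xy(3) by (simp add: linear_diff[OF f])
    finally show "x = y" by simp
  qed
  then have "dim (f ` U) = dim U"
    using f U(1) by (intro dim_image_eq) (simp_all add: span_eq_iff[THEN iffD2])
  then have onto: "f ` U = U"
    using U f by (intro subspace_dim_equal) (auto intro: linear_subspace_image)
  have "f x \<in> complement_in W U" if x: "x \<in> complement_in W U" for x
  proof -
    have "orthogonal y (f x)" if "y \<in> U" for y
    proof -
      obtain z where "z \<in> U" "y = f z" using \<open>y \<in> U\<close> onto by auto
      then show ?thesis using x inner U(2) by (auto simp: complement_in_def orthogonal_def subset_iff)
    qed
    then show ?thesis using x W by (auto simp: complement_in_def)
  qed
  then show ?thesis
    using f inner by (auto simp: isometric_on_def complement_in_def)
qed

text \<open>Orthonormal bases of \<open>U\<close> and of its complement together form one of \<open>W\<close>, and the diagonal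
  entries of \<open>f\<close> in this basis split accordingly.\<close>
lemma trace_on_complement:
  fixes f :: "'a::euclidean_space \<Rightarrow> 'a"
  assumes iso: "isometric_on W f" and W: "subspace W"
    and U: "subspace U" "U \<subseteq> W" "f ` U \<subseteq> U"
  shows "trace_on W f = trace_on U f + trace_on (complement_in W U) f"
proof -
  let ?C = "complement_in W U"
  have isoC: "isometric_on ?C f" by (rule isometric_on_complement[OF iso U])
  have C: "subspace ?C" by (rule subspace_complement_in[OF W])
  obtain A where A: "A \<subseteq> U" "pairwise orthogonal A" "\<And>b. b \<in> A \<Longrightarrow> norm b = 1"
    "independent A" "card A = dim U" "span A = U"
    using orthonormal_basis_subspace[OF U(1)] by blast
  obtain B where B: "B \<subseteq> ?C" "pairwise orthogonal B" "\<And>b. b \<in> B \<Longrightarrow> norm b = 1"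
    "independent B" "card B = dim ?C" "span B = ?C"
    using orthonormal_basis_subspace[OF C] by blast
  have fin: "finite A" "finite B" using A(4) B(4) independent_imp_finite by blast+
  have cross: "orthogonal a b" if "a \<in> A" "b \<in> B" for a b
    using that A(1) B(1) by (auto simp: complement_in_def)
  have disj: "A \<inter> B = {}"
  proof -
    have False if "a \<in> A" "a \<in> B" for a
      using cross[OF that] A(3)[OF that(1)] by (simp add: orthogonal_self)
    then show ?thesis by blast
  qed
  have orth: "pairwise orthogonal (A \<union> B)"
    using A(2) B(2) cross cross[THEN orthogonal_commute[THEN iffD1]]
    unfolding pairwise_def by blast
  have norm: "norm b = 1" if "b \<in> A \<union> B" for b
    using that A(3) B(3) by auto
  have sub: "A \<union> B \<subseteq> W" using A(1) B(1) U(2) by (auto simp: complement_in_def)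
  have "independent (A \<union> B)"
    using orth by (rule pairwise_orthogonal_independent) (use norm in force)
  moreover have "card (A \<union> B) = dim W"
    using dim_subspace_orthogonal_to_vectors[OF U(1) W U(2)] A(5) B(5) disj fin
    by (simp add: card_Un_disjoint complement_in_def)
  ultimately have "W \<subseteq> span (A \<union> B)"
    using sub fin by (intro card_ge_dim_independent) auto
  then have "span (A \<union> B) = W"
    using sub W by (simp add: span_minimal subset_antisym)
  then have "trace_on W f = (\<Sum>b\<in>A \<union> B. f b \<bullet> b)"
    using trace_on_orthonormal orth norm iso unfolding isometric_on_def by blast
  also have "\<dots> = (\<Sum>b\<in>A. f b \<bullet> b) + (\<Sum>b\<in>B. f b \<bullet> b)"
    using disj fin by (simp add: sum.union_disjoint)
  also have "(\<Sum>b\<in>A. f b \<bullet> b) = trace_on U f"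
    using trace_on_orthonormal[of f U A] A iso U(3) by (simp add: isometric_on_def)
  also have "(\<Sum>b\<in>B. f b \<bullet> b) = trace_on ?C f"
    using trace_on_orthonormal[of f ?C B] B isoC by (simp add: isometric_on_def)
  finally show ?thesis .
qed

lemma dim_complement_in:
  fixes W :: "'a::euclidean_space set"
  assumes "subspace W" "subspace U" "U \<subseteq> W"
  shows "dim (complement_in W U) + dim U = dim W"
  using dim_subspace_orthogonal_to_vectors[OF assms(2,1,3)] by (simp add: complement_in_def)

lemma trace_on_scaling:
  fixes f :: "'a::euclidean_space \<Rightarrow> 'a"
  assumes "linear f" "subspace W" "\<And>x. x \<in> W \<Longrightarrow> f x = l *\<^sub>R x"
  shows "trace_on W f = l * real (dim W)"
proof -
  obtain B where B: "B \<subseteq> W" "independent B" "card B = dim W" "span B = W"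
    using orthonormal_basis_subspace[OF assms(2)] by metis
  then have "trace_on W f = (\<Sum>b\<in>B. l)"
    using assms by (intro trace_on_eigenbasis) auto
  then show ?thesis using B by simp
qed

section \<open>The dimension of the space of skew-symmetric matrices\<close>

definition skew_matrices :: "(real^'d^'d) set" where
  "skew_matrices = {A. transpose A = - A}"

lemma linear_transpose: "linear (transpose :: real^'d^'d \<Rightarrow> real^'d^'d)"
  by (auto intro!: linearI simp: transpose_def vec_eq_iff)

lemma subspace_skew_matrices: "subspace skew_matrices"
  by (simp add: skew_matrices_def subspace_def linear_0[OF linear_transpose]
      linear_add[OF linear_transpose] linear_scale[OF linear_transpose])

lemma inner_transpose: "transpose A \<bullet> transpose B = A \<bullet> (B :: real^'d^'d)"
  unfolding inner_vec_def transpose_def by (simp, rule sum.swap)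

text \<open>Transposition permutes the elementary matrices and fixes exactly the diagonal ones.\<close>
lemma trace_on_transpose: "trace_on UNIV (transpose :: real^'d^'d \<Rightarrow> real^'d^'d) = real CARD('d)"
proof -
  let ?e = "\<lambda>(i, j). axis i (axis j 1) :: real^'d^'d"
  have inj: "inj_on ?e (UNIV \<times> UNIV)"
    by (auto simp: inj_on_def axis_eq_axis)
  have B: "(Basis :: (real^'d^'d) set) = ?e ` (UNIV \<times> UNIV)"
    by (auto simp: Basis_vec_def)
  have diag: "transpose (axis i (axis j 1)) \<bullet> (axis i (axis j 1) :: real^'d^'d) =
      (if i = j then 1 else 0)" for i j
    by (simp add: inner_axis) (simp add: transpose_def axis_def)
  have "trace_on UNIV (transpose :: real^'d^'d \<Rightarrow> real^'d^'d) = (\<Sum>b\<in>Basis. transpose b \<bullet> (b :: real^'d^'d))"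
    by (rule trace_on_coordinate_subspace) (auto simp: linear_transpose span_Basis)
  also have "\<dots> = (\<Sum>x\<in>UNIV \<times> UNIV. transpose (?e x) \<bullet> ?e x)"
    unfolding B by (rule sum.reindex[OF inj, unfolded o_def])
  also have "\<dots> = (\<Sum>(i::'d, j::'d)\<in>UNIV \<times> UNIV. if i = j then 1 else 0)"
    by (intro sum.cong refl) (clarsimp simp: diag)
  also have "\<dots> = (\<Sum>i::'d\<in>UNIV. \<Sum>j::'d\<in>UNIV. if i = j then 1 else 0)"
    by (rule sum.cartesian_product[symmetric])
  also have "\<dots> = real CARD('d)" by simp
  finally show ?thesis .
qed

text \<open>Transposition acts as \<open>-1\<close> on the skew matrices and as \<open>1\<close> on their orthogonal complement, the
  symmetric ones. Hence the dimensions of the two spaces differ by the trace \<open>d\<close> of transposition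
  and add up to \<open>d\<^sup>2\<close>. This determines both without an ordering of the index type.\<close>
lemma dim_skew_matrices:
  "real (dim (skew_matrices :: (real^'d^'d) set)) =
    (real CARD('d) * real CARD('d) - real CARD('d)) / 2"
proof -
  let ?S = "skew_matrices :: (real^'d^'d) set"
  let ?C = "complement_in UNIV ?S"
  have iso: "isometric_on UNIV (transpose :: real^'d^'d \<Rightarrow> _)"
    by (simp add: isometric_on_def linear_transpose inner_transpose)
  have inv: "transpose ` ?S \<subseteq> ?S"
    by (auto simp: skew_matrices_def) (metis transpose_transpose)
  have isoC: "isometric_on ?C transpose"
    by (rule isometric_on_complement[OF iso subspace_skew_matrices]) (use inv in auto)
  have sym: "transpose A = A" if A: "A \<in> ?C" for A
  proof -
    have "transpose A \<in> ?C" using isoC A by (auto simp: isometric_on_def)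
    moreover have "A - transpose A \<in> ?S"
      by (simp add: skew_matrices_def transpose_def vec_eq_iff)
    ultimately have "(A - transpose A) \<bullet> A = 0" "(A - transpose A) \<bullet> transpose A = 0"
      using A by (auto simp: complement_in_def orthogonal_def)
    then have "(A - transpose A) \<bullet> (A - transpose A) = 0" by (simp add: inner_diff_right)
    then show ?thesis by simp
  qed
  have "real CARD('d) = trace_on ?S transpose + trace_on ?C transpose"
    using trace_on_complement[OF iso subspace_UNIV subspace_skew_matrices _ inv]
      trace_on_transpose[where 'd='d] by simp
  also have "trace_on ?S transpose = - 1 * real (dim ?S)"
    by (rule trace_on_scaling[OF linear_transpose subspace_skew_matrices])
      (simp add: skew_matrices_def)
  also have "trace_on ?C transpose = 1 * real (dim ?C)"
    by (rule trace_on_scaling[OF linear_transpose subspace_complement_in[OF subspace_UNIV]])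
      (simp add: sym)
  finally have "real CARD('d) = real (dim ?C) - real (dim ?S)" by simp
  moreover have "dim ?C + dim ?S = DIM(real^'d^'d)"
    using dim_complement_in[OF subspace_UNIV subspace_skew_matrices] by simp
  then have "real (dim ?C) + real (dim ?S) = real CARD('d) * real CARD('d)"
    by (metis DIM_cart DIM_real mult_1_right of_nat_add of_nat_mult)
  ultimately show ?thesis by simp
qed

section \<open>Families of vectors, rows of the rigidity matrix and trivial flexes\<close>

definition families :: "'v::finite set \<Rightarrow> ((real^'d)^'v) set" where
  "families V = {u. \<forall>i. i \<notin> V \<longrightarrow> u $ i = 0}"

text \<open>A row of the rigidity matrix, read as a family of vectors of \<open>\<real>\<^sup>d\<close> indexed by the vertices,
  so that it lies in the space on which the symmetries act.\<close>
definition edge_row :: "('v::finite \<Rightarrow> real^'d) \<Rightarrow> 'v set \<Rightarrow> (real^'d)^'v" where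
  "edge_row p e = (\<chi> i. if i \<in> e then p i - p (the_elem (e - {i})) else 0)"

text \<open>The velocities at the points of the framework of the infinitesimal rigid motion with linear part
  \<open>A\<close> and velocity \<open>b\<close> at \<open>q\<close>. Keeping \<open>q\<close> variable makes the action of a symmetry simple: it
  moves \<open>q\<close> to \<open>T q\<close>, and a fixed point \<open>q\<close> separates the rotations from the translations.\<close>
definition rigid_flex ::
    "'v::finite set \<Rightarrow> ('v \<Rightarrow> real^'d) \<Rightarrow> real^'d \<Rightarrow> (real^'d^'d) \<times> (real^'d) \<Rightarrow> (real^'d)^'v" where
  "rigid_flex V p q = (\<lambda>(A, b). \<chi> i. if i \<in> V then A *v (p i - q) + b else 0)"

text \<open>No infinitesimal rigid motion other than 0 is invisible at the points of \<open>V\<close>. Equivalently, the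
  trivial flexes have the full dimension \<open>d * (d + 1) / 2\<close>. Besides points that affinely span the
  space, this covers two distinct points in the plane.\<close>
definition flex_determining :: "'v set \<Rightarrow> ('v \<Rightarrow> real^'d) \<Rightarrow> bool" where
  "flex_determining V p \<longleftrightarrow>
    (\<forall>A\<in>skew_matrices. \<forall>b. (\<forall>i\<in>V. A *v p i + b = 0) \<longrightarrow> A = 0 \<and> b = 0)"

lemma subspace_families: "subspace (families V)"
  by (auto simp: families_def subspace_def)

lemma edge_row_pair:
  assumes "u \<noteq> v"
  shows "edge_row p {u, v} = axis u (p u - p v) + axis v (p v - p u)"
proof -
  have "{u, v} - {u} = {v}" "{u, v} - {v} = {u}" using assms by auto
  then show ?thesis using assms by (auto simp: edge_row_def vec_eq_iff axis_def)
qed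

lemma inner_edge_row:
  assumes "u \<noteq> v"
  shows "x \<bullet> edge_row p {u, v} = (x $ u - x $ v) \<bullet> (p u - p v)"
  unfolding edge_row_pair[OF assms]
  by (simp add: inner_axis inner_simps)

lemma edge_row_in_families: "e \<subseteq> V \<Longrightarrow> edge_row p e \<in> families V"
  by (auto simp: families_def edge_row_def)

lemma linear_rigid_flex: "linear (rigid_flex V p q)"
  by (rule linearI)
    (auto simp: rigid_flex_def vec_eq_iff matrix_vector_mult_add_rdistrib scaleR_matrix_vector_assoc[symmetric]
      algebra_simps)

lemma skew_inner_self:
  assumes "A \<in> skew_matrices"
  shows "(A *v x) \<bullet> x = 0"
proof -
  have "(A *v x) \<bullet> x = x \<bullet> (transpose A *v x)"
    by (metis dot_lmul_matrix inner_commute vector_transpose_matrix transpose_transpose)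
  also have "transpose A *v x = - (A *v x)"
    using assms by (simp add: skew_matrices_def matrix_vector_mult_def vec_eq_iff sum_negf)
  finally show ?thesis by (simp add: inner_commute)
qed

lemma trivial_flexes_eq_image: "trivial_flexes V p = rigid_flex V p q ` (skew_matrices \<times> UNIV)"
proof (rule set_eqI, rule iffI)
  fix x assume "x \<in> trivial_flexes V p"
  then obtain A b where A: "transpose A = - A"
    and x: "x = (\<chi> i. if i \<in> V then A *v p i + b else 0)"
    by (auto simp: trivial_flexes_def)
  have "x = rigid_flex V p q (A, A *v q + b)"
    by (simp add: x rigid_flex_def vec_eq_iff matrix_vector_mult_diff_distrib)
  then show "x \<in> rigid_flex V p q ` (skew_matrices \<times> UNIV)"
    using A by (auto simp: skew_matrices_def)
next
  fix x assume "x \<in> rigid_flex V p q ` (skew_matrices \<times> UNIV)"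
  then obtain A b where A: "transpose A = - A" and x: "x = rigid_flex V p q (A, b)"
    by (auto simp: skew_matrices_def)
  have "x = (\<chi> i. if i \<in> V then A *v p i + (b - A *v q) else 0)"
    by (simp add: x rigid_flex_def vec_eq_iff matrix_vector_mult_diff_distrib)
  then show "x \<in> trivial_flexes V p"
    using A by (auto simp: trivial_flexes_def)
qed

lemma subspace_trivial_flexes: "subspace (trivial_flexes V p)"
  unfolding trivial_flexes_eq_image[of V p 0]
  by (intro linear_subspace_image linear_rigid_flex subspace_Times subspace_skew_matrices subspace_UNIV)

lemma trivial_flexes_subset: "trivial_flexes V p \<subseteq> families V"
  by (auto simp: trivial_flexes_def families_def)

text \<open>Rigid motions preserve edge lengths to first order: \<open>(A *v (p u - p v)) \<bullet> (p u - p v) = 0\<close>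
  for skew \<open>A\<close>.\<close>
lemma edge_row_orthogonal_trivial_flex:
  assumes "u \<noteq> v" "{u, v} \<subseteq> V" "x \<in> trivial_flexes V p"
  shows "orthogonal (edge_row p {u, v}) x"
proof -
  obtain A b where A: "A \<in> skew_matrices"
    and x: "x = (\<chi> i. if i \<in> V then A *v p i + b else 0)"
    using assms(3) by (auto simp: trivial_flexes_def skew_matrices_def)
  have "x \<bullet> edge_row p {u, v} = (A *v (p u - p v)) \<bullet> (p u - p v)"
    using assms(2) by (simp add: inner_edge_row[OF assms(1)] x matrix_vector_mult_diff_distrib)
  then show ?thesis
    by (simp add: orthogonal_def skew_inner_self[OF A] inner_commute[of "edge_row p {u, v}"])
qed

lemma inj_on_rigid_flex:
  assumes "flex_determining V p"
  shows "inj_on (rigid_flex V p q) (skew_matrices \<times> UNIV)"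
proof (rule inj_onI)
  fix x y assume x: "x \<in> skew_matrices \<times> UNIV" and y: "y \<in> skew_matrices \<times> UNIV"
    and eq: "rigid_flex V p q x = rigid_flex V p q y"
  obtain A b where Ab: "x - y = (A, b)" by fastforce
  have A: "A \<in> skew_matrices"
    using x y Ab subspace_diff[OF subspace_skew_matrices] by (cases x; cases y) auto
  have "rigid_flex V p q (A, b) = 0"
    using eq linear_diff[OF linear_rigid_flex, of V p q x y] by (simp add: Ab)
  then have "A *v (p i - q) + b = 0" if "i \<in> V" for i
  proof -
    have "rigid_flex V p q (A, b) $ i = 0"
      using \<open>rigid_flex V p q (A, b) = 0\<close> by simp
    then show ?thesis using that by (simp add: rigid_flex_def)
  qed
  then have "\<forall>i\<in>V. A *v p i + (b - A *v q) = 0"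
    by (simp add: matrix_vector_mult_diff_distrib algebra_simps)
  then have "A = 0 \<and> b - A *v q = 0"
    using assms A unfolding flex_determining_def by blast
  then show "x = y" using Ab by (simp add: zero_prod_def[symmetric])
qed

lemma dim_trivial_flexes:
  fixes p :: "'v::finite \<Rightarrow> real^'d"
  assumes "flex_determining V p"
  shows "real (dim (trivial_flexes V p)) = real (CARD('d) * (CARD('d) + 1)) / 2"
proof -
  let ?S = "(skew_matrices :: (real^'d^'d) set) \<times> (UNIV :: (real^'d) set)"
  have sp: "span ?S = ?S"
    by (simp add: span_eq_iff subspace_Times subspace_skew_matrices)
  have "dim (rigid_flex V p 0 ` ?S) = dim ?S"
    by (rule dim_image_eq[OF linear_rigid_flex])
      (simp add: sp inj_on_rigid_flex[OF assms])
  also have "\<dots> = dim (skew_matrices :: (real^'d^'d) set) + CARD('d)"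
    by (subst dim_Times) (simp_all add: subspace_skew_matrices)
  finally show ?thesis
    unfolding trivial_flexes_eq_image[of V p 0]
    by (simp add: dim_skew_matrices field_simps)
qed

text \<open>If \<open>A *v p i + b = 0\<close> for all \<open>i\<close>, every nonzero row of \<open>A\<close> is the normal vector of a hyperplane
  through all the points.\<close>
lemma flex_determining_if_not_in_hyperplane:
  assumes "\<not> in_hyperplane (p ` V)"
  shows "flex_determining V p"
  unfolding flex_determining_def
proof (intro ballI allI impI)
  fix A b assume z: "\<forall>i\<in>V. A *v p i + b = 0"
  have "A $ k = 0" for k
  proof (rule ccontr)
    assume "A $ k \<noteq> 0"
    moreover have "A $ k \<bullet> p i = - b $ k" if "i \<in> V" for i
    proof -
      have "(A *v p i + b) $ k = 0" using z that by simp
      then show ?thesis by (simp add: matrix_vector_mul_component)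
    qed
    ultimately have "in_hyperplane (p ` V)" unfolding in_hyperplane_def by blast
    then show False using assms by simp
  qed
  then have "A = 0" by (simp add: vec_eq_iff)
  moreover have "V \<noteq> {}"
  proof
    assume "V = {}"
    moreover have "axis undefined 1 \<noteq> (0 :: real^'a)" by (simp add: axis_eq_0_iff)
    ultimately show False using assms unfolding in_hyperplane_def by blast
  qed
  ultimately show "A = 0 \<and> b = 0" using z by auto
qed

text \<open>The rank is at most the number of distinct nonzero rows; since it equals the number of edges, the
  rows of the edges are pairwise distinct and linearly independent.\<close>
lemma isostatic_rows:
  fixes p :: "'v::finite \<Rightarrow> real^'d"
  assumes "isostatic E p"
  shows "inj_on (edge_row p) E" "independent (edge_row p ` E)"
proof -
  \<comment> \<open>rewrites a family of vectors as one vector indexed by the columns of the rigidity matrix\<close>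
  define vec :: "(real^'d)^'v \<Rightarrow> real^('v \<times> 'd)" where "vec u = (\<chi> c. u $ fst c $ snd c)" for u
  have vec: "linear vec" by (rule linearI) (simp_all add: vec_def vec_eq_iff)
  have fin: "finite E" by simp
  have row: "row e (rigidity_matrix E p) = (if e \<in> E then vec (edge_row p e) else 0)" for e
    by (auto simp: row_def rigidity_matrix_def vec_def edge_row_def vec_eq_iff)
  have "rows (rigidity_matrix E p) \<subseteq> insert 0 (vec ` edge_row p ` E)"
    by (auto simp: rows_def row)
  then have "rank (rigidity_matrix E p) \<le> dim (insert 0 (vec ` edge_row p ` E))"
    unfolding row_rank_def by (rule dim_subset)
  also have "\<dots> = dim (vec ` edge_row p ` E)" by (metis dim_span span_insert_0)
  also have "\<dots> \<le> dim (edge_row p ` E)" by (rule dim_image_le[OF vec])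
  finally have le: "card E \<le> dim (edge_row p ` E)"
    using assms by (simp add: isostatic_def)
  have le2: "dim (edge_row p ` E) \<le> card (edge_row p ` E)"
    by (rule dim_le_card) (auto simp: span_superset)
  have le3: "card (edge_row p ` E) \<le> card E" by (rule card_image_le[OF fin])
  show "inj_on (edge_row p) E"
    using le le2 le3 by (intro eq_card_imp_inj_on fin) simp
  show "independent (edge_row p ` E)"
    by (rule card_le_dim_spanning[of _ "edge_row p ` E"]) (use le le3 in \<open>auto simp: span_superset\<close>)
qed

lemma families_basis:
  fixes V :: "'v::finite set"
  defines "B \<equiv> (\<lambda>(i, k). axis i (axis k 1)) ` (V \<times> (UNIV :: 'd::finite set))"
  shows "B \<subseteq> (Basis :: ((real^'d)^'v) set)" "span B = families V"
    "inj_on (\<lambda>(i, k). axis i (axis k 1) :: (real^'d)^'v) (V \<times> (UNIV :: 'd set))"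
proof -
  show sub: "B \<subseteq> (Basis :: ((real^'d)^'v) set)"
    by (auto simp: B_def Basis_vec_def)
  show "inj_on (\<lambda>(i, k). axis i (axis k 1) :: (real^'d)^'v) (V \<times> (UNIV :: 'd set))"
    by (auto simp: inj_on_def axis_eq_axis)
  have "B \<subseteq> families V" by (auto simp: B_def families_def axis_def)
  then have "span B \<subseteq> families V" by (simp add: span_minimal subspace_families)
  moreover have "families V \<subseteq> span B"
  proof
    fix u :: "(real^'d)^'v" assume u: "u \<in> families V"
    have "u = (\<Sum>b\<in>Basis. (u \<bullet> b) *\<^sub>R b)" by (simp add: euclidean_representation)
    moreover have "(u \<bullet> b) *\<^sub>R b \<in> span B" if b: "b \<in> Basis" for b
    proof -
      obtain i k where ik: "b = axis i (axis k 1)" using b by (auto simp: Basis_vec_def)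
      show ?thesis
      proof (cases "i \<in> V")
        case True
        then have "b \<in> B" by (auto simp: B_def ik)
        then show ?thesis by (simp add: span_base span_mul)
      next
        case False
        then have "u \<bullet> b = 0" using u by (simp add: ik inner_axis families_def)
        then show ?thesis by (simp add: span_zero)
      qed
    qed
    ultimately show "u \<in> span B" by (metis (no_types, lifting) span_sum)
  qed
  ultimately show "span B = families V" by blast
qed

lemma dim_families: "dim (families V :: ((real^'d)^'v) set) = CARD('d) * card V"
proof -
  let ?e = "\<lambda>(i, k). axis i (axis k 1) :: (real^'d)^'v"
  let ?B = "?e ` (V \<times> (UNIV :: 'd set))"
  have "independent ?B"
    using families_basis(1) independent_Basis independent_mono by metis
  then have "dim (span ?B) = card ?B" by (simp add: dim_eq_card_independent)
  also have "card ?B = CARD('d) * card V"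
    by (subst card_image[OF families_basis(3)]) (simp add: card_cartesian_product)
  finally show ?thesis by (simp add: families_basis(2))
qed

section \<open>The action of a spatial symmetry\<close>

locale framework_symmetry =
  fixes V :: "'v::finite set" and E :: "'v set set" and p :: "'v \<Rightarrow> real^'d"
    and \<sigma> :: "'v \<Rightarrow> 'v" and T :: "real^'d \<Rightarrow> real^'d"
  assumes graph: "simple_graph V E" and sym: "spatial_symmetry V E p \<sigma> T"
begin

lemma edgeE:
  assumes "e \<in> E"
  obtains u v where "u \<noteq> v" "e = {u, v}" "u \<in> V" "v \<in> V"
  using assms graph unfolding simple_graph_def by (metis card_2_iff insert_subset)

lemma bij: "bij_betw \<sigma> V V" and p_\<sigma>: "i \<in> V \<Longrightarrow> p (\<sigma> i) = T (p i)"
  using sym by (auto simp: spatial_symmetry_def graph_automorphism_def)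

lemma \<sigma>_in: "i \<in> V \<Longrightarrow> \<sigma> i \<in> V"
  using bij bij_betwE by blast

lemma \<sigma>_eq_iff: "i \<in> V \<Longrightarrow> j \<in> V \<Longrightarrow> \<sigma> i = \<sigma> j \<longleftrightarrow> i = j"
  using bij by (auto simp: bij_betw_def inj_on_def)

lemma \<sigma>_edge: "e \<in> E \<Longrightarrow> \<sigma> ` e \<in> E"
proof -
  assume e: "e \<in> E"
  then obtain u v where "e = {u, v}" "u \<in> V" "v \<in> V" by (rule edgeE)
  then show ?thesis
    using e sym by (auto simp: spatial_symmetry_def graph_automorphism_def)
qed

lemma orthogonal_rho_sp: "orthogonal_transformation (rho_sp T)"
  unfolding orthogonal_transformation_isometry
  using sym by (auto simp: spatial_symmetry_def rho_sp_def dist_norm)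

lemma linear_rho_sp: "linear (rho_sp T)"
  using orthogonal_rho_sp by (simp add: orthogonal_transformation_def)

lemma rho_sp_diff: "rho_sp T (x - y) = T x - T y"
  by (simp add: linear_diff[OF linear_rho_sp]) (simp add: rho_sp_def)

lemma rho_v_\<sigma>: "i \<in> V \<Longrightarrow> rho_v V \<sigma> T u $ \<sigma> i = rho_sp T (u $ i)"
  using bij \<sigma>_in by (simp add: rho_v_def bij_betw_def)

lemma rho_v_in_families: "rho_v V \<sigma> T u \<in> families V"
  by (simp add: rho_v_def families_def)

lemma rho_v_eqI:
  assumes "w \<in> families V" "\<And>i. i \<in> V \<Longrightarrow> w $ \<sigma> i = rho_sp T (u $ i)"
  shows "rho_v V \<sigma> T u = w"
proof (rule vec_eq_iff[THEN iffD2], rule allI)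
  fix j
  show "rho_v V \<sigma> T u $ j = w $ j"
  proof (cases "j \<in> V")
    case True
    then obtain i where "i \<in> V" "j = \<sigma> i" using bij by (auto simp: bij_betw_def)
    then show ?thesis using assms(2) by (simp add: rho_v_\<sigma>)
  next
    case False
    then show ?thesis using assms(1) by (simp add: rho_v_def families_def)
  qed
qed

text \<open>The action permutes the components of a family and applies an orthogonal map to each of them.\<close>
lemma isometric_on_rho_v: "isometric_on (families V) (rho_v V \<sigma> T)"
proof -
  have "linear (rho_v V \<sigma> T)"
    by (rule linearI) (auto simp: rho_v_def vec_eq_iff linear_add[OF linear_rho_sp]
        linear_scale[OF linear_rho_sp])
  moreover have "rho_v V \<sigma> T x \<bullet> rho_v V \<sigma> T y = x \<bullet> y" if "x \<in> families V" for x y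
  proof -
    have "rho_v V \<sigma> T x \<bullet> rho_v V \<sigma> T y = (\<Sum>j\<in>V. rho_v V \<sigma> T x $ j \<bullet> rho_v V \<sigma> T y $ j)"
      unfolding inner_vec_def by (rule sum.mono_neutral_right) (auto simp: rho_v_def)
    also have "\<dots> = (\<Sum>i\<in>V. rho_v V \<sigma> T x $ \<sigma> i \<bullet> rho_v V \<sigma> T y $ \<sigma> i)"
      by (rule sum.reindex_bij_betw[OF bij, symmetric])
    also have "\<dots> = (\<Sum>i\<in>V. x $ i \<bullet> y $ i)"
      using orthogonal_rho_sp by (simp add: rho_v_\<sigma> orthogonal_transformation_def)
    also have "\<dots> = x \<bullet> y"
      unfolding inner_vec_def
      by (rule sum.mono_neutral_left) (use that in \<open>auto simp: families_def\<close>)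
    finally show ?thesis .
  qed
  ultimately show ?thesis
    using rho_v_in_families by (auto simp: isometric_on_def)
qed

lemma linear_rho_v: "linear (rho_v V \<sigma> T)"
  using isometric_on_rho_v by (simp add: isometric_on_def)

text \<open>Written in blocks indexed by the vertices, the action has a diagonal block only at the unmoved
  vertices, and there this block is the linear part of the isometry.\<close>
lemma trace_families:
  "trace_on (families V) (rho_v V \<sigma> T) = trace_sp T * real (card (unmoved_vertices V \<sigma>))"
proof -
  let ?e = "\<lambda>(i, k). axis i (axis k 1) :: (real^'d)^'v"
  have diag: "rho_v V \<sigma> T (axis i (axis k 1)) \<bullet> axis i (axis k 1) =
      (if \<sigma> i = i then matrix (rho_sp T) $ k $ k else 0)" if i: "i \<in> V" for i k
  proof -
    obtain j where j: "j \<in> V" "i = \<sigma> j" using bij i by (auto simp: bij_betw_def)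
    then have "j = i \<longleftrightarrow> \<sigma> i = i" using \<sigma>_eq_iff i by metis
    moreover have "rho_v V \<sigma> T (axis i (axis k 1)) $ i = rho_sp T (axis i (axis k 1) $ j)"
      using rho_v_\<sigma>[OF j(1)] j(2) by simp
    moreover have "axis i (axis k (1::real)) $ j = (if j = i then axis k 1 else 0)"
      by (simp add: axis_def)
    ultimately show ?thesis
      by (simp add: inner_axis matrix_def linear_0[OF linear_rho_sp])
  qed
  have "trace_on (families V) (rho_v V \<sigma> T) =
      (\<Sum>b\<in>?e ` (V \<times> UNIV). rho_v V \<sigma> T b \<bullet> b)"
    using isometric_on_rho_v families_basis(1,2)
    by (intro trace_on_coordinate_subspace) (auto simp: isometric_on_def)
  also have "\<dots> = (\<Sum>x\<in>V \<times> UNIV. rho_v V \<sigma> T (?e x) \<bullet> ?e x)"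
    by (rule sum.reindex[OF families_basis(3), unfolded o_def])
  also have "\<dots> = (\<Sum>(i, k)\<in>V \<times> UNIV. if \<sigma> i = i then matrix (rho_sp T) $ k $ k else 0)"
    by (intro sum.cong refl) (clarsimp simp: diag)
  also have "\<dots> = (\<Sum>i\<in>V. \<Sum>k\<in>UNIV. if \<sigma> i = i then matrix (rho_sp T) $ k $ k else 0)"
    by (rule sum.cartesian_product[symmetric])
  also have "\<dots> = (\<Sum>i\<in>V. if \<sigma> i = i then trace_sp T else 0)"
    by (intro sum.cong refl) (simp add: trace_sp_def trace_def)
  also have "\<dots> = (\<Sum>i\<in>unmoved_vertices V \<sigma>. trace_sp T)"
    unfolding unmoved_vertices_def by (rule sum.inter_filter[symmetric]) simp
  finally show ?thesis by simp
qed

text \<open>This is where the isometry enters: \<open>T (p u) - T (p v)\<close> is the image of \<open>p u - p v\<close> under the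
  linear part of \<open>T\<close>. It makes the span of the rows a permutation representation on the edges.\<close>
lemma rho_v_edge_row:
  assumes "e \<in> E"
  shows "rho_v V \<sigma> T (edge_row p e) = edge_row p (\<sigma> ` e)"
proof -
  obtain u v where uv: "u \<noteq> v" "e = {u, v}" "u \<in> V" "v \<in> V" using assms by (rule edgeE)
  have ne: "\<sigma> u \<noteq> \<sigma> v" using uv \<sigma>_eq_iff by simp
  show ?thesis
  proof (rule rho_v_eqI)
    show "edge_row p (\<sigma> ` e) \<in> families V"
      using uv \<sigma>_in by (intro edge_row_in_families) auto
    fix i assume i: "i \<in> V"
    show "edge_row p (\<sigma> ` e) $ \<sigma> i = rho_sp T (edge_row p e $ i)"
      using uv ne i
      by (auto simp: edge_row_pair axis_def \<sigma>_eq_iff rho_sp_diff p_\<sigma> linear_0[OF linear_rho_sp])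
  qed
qed

lemma trace_edge_rows:
  assumes "inj_on (edge_row p) E" "independent (edge_row p ` E)"
  shows "trace_on (span (edge_row p ` E)) (rho_v V \<sigma> T) = real (card (unmoved_edges E \<sigma>))"
proof -
  have "trace_on (span (edge_row p ` E)) (rho_v V \<sigma> T) =
      real (card {b \<in> edge_row p ` E. rho_v V \<sigma> T b = b})"
    by (rule trace_on_permuted_basis[OF linear_rho_v assms(2) refl])
      (auto simp: rho_v_edge_row \<sigma>_edge)
  also have "{b \<in> edge_row p ` E. rho_v V \<sigma> T b = b} = edge_row p ` unmoved_edges E \<sigma>"
    using inj_on_eq_iff[OF assms(1)] \<sigma>_edge
    by (auto simp: unmoved_edges_def rho_v_edge_row)
  also have "card \<dots> = card (unmoved_edges E \<sigma>)"
    by (rule card_image) (rule inj_on_subset[OF assms(1)], auto simp: unmoved_edges_def)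
  finally show ?thesis .
qed

text \<open>The matrix \<open>B\<close> is the conjugate of \<open>A\<close> by the linear part of \<open>T\<close>, described by an intertwining
  condition that can be checked without computing an inverse.\<close>
lemma rho_v_rigid_flex:
  assumes "\<And>x. B *v rho_sp T x = rho_sp T (A *v x)"
  shows "rho_v V \<sigma> T (rigid_flex V p q (A, b)) = rigid_flex V p (T q) (B, rho_sp T b)"
proof (rule rho_v_eqI)
  fix i assume i: "i \<in> V"
  show "rigid_flex V p (T q) (B, rho_sp T b) $ \<sigma> i = rho_sp T (rigid_flex V p q (A, b) $ i)"
    using i \<sigma>_in[OF i] assms[of "p i - q"]
    by (simp add: rigid_flex_def p_\<sigma> linear_add[OF linear_rho_sp] rho_sp_diff)
qed (simp add: rigid_flex_def families_def)

lemma rho_v_trivial_flexes: "rho_v V \<sigma> T ` trivial_flexes V p \<subseteq> trivial_flexes V p"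
proof (rule image_subsetI)
  fix x assume "x \<in> trivial_flexes V p"
  then obtain A b where A: "A \<in> skew_matrices" and x: "x = rigid_flex V p 0 (A, b)"
    using trivial_flexes_eq_image[of V p 0] by auto
  define R where "R = matrix (rho_sp T)"
  have R: "R *v y = rho_sp T y" for y
    unfolding R_def by (simp add: matrix_works linear_rho_sp)
  have RR: "transpose R ** R = mat 1"
    using orthogonal_rho_sp by (simp add: R_def orthogonal_transformation_matrix orthogonal_matrix)
  \<comment> \<open>conjugation by an orthogonal matrix preserves skew-symmetry\<close>
  define B where "B = R ** A ** transpose R"
  have "B *v rho_sp T y = rho_sp T (A *v y)" for y
  proof -
    have "B *v (R *v y) = R *v (A *v ((transpose R ** R) *v y))"
      by (simp add: B_def matrix_vector_mul_assoc matrix_mul_assoc)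
    then show ?thesis by (simp add: RR R)
  qed
  then have "rho_v V \<sigma> T x = rigid_flex V p (T 0) (B, rho_sp T b)"
    unfolding x by (rule rho_v_rigid_flex)
  moreover have "B \<in> skew_matrices"
  proof -
    have "transpose B = R ** transpose A ** transpose R"
      by (simp add: B_def matrix_transpose_mul matrix_mul_assoc)
    also have "\<dots> = - B"
      using A by (simp add: B_def skew_matrices_def matrix_matrix_mult_def vec_eq_iff sum_negf)
    finally show ?thesis by (simp add: skew_matrices_def)
  qed
  ultimately show "rho_v V \<sigma> T x \<in> trivial_flexes V p"
    unfolding trivial_flexes_eq_image[of V p "T 0"] by blast
qed

text \<open>The space of families is the orthogonal sum of the span of the rows, the trivial flexes and a
  remainder, all of them invariant. The expression between the bars is the trace on the remainder
  and the right-hand side is the dimension of the remainder.\<close>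
lemma symmetric_count:
  assumes rows: "inj_on (edge_row p) E" "independent (edge_row p ` E)"
    and det: "flex_determining V p"
  shows "\<bar>trace_sp T * real (card (unmoved_vertices V \<sigma>)) - real (card (unmoved_edges E \<sigma>))
           - trace_rig V p \<sigma> T\<bar>
         \<le> real (CARD('d) * card V) - real (card E) - real (CARD('d) * (CARD('d) + 1)) / 2"
proof -
  let ?f = "rho_v V \<sigma> T"
  define W :: "((real^'d)^'v) set" where "W = families V"
  define S where "S = span (edge_row p ` E)"
  define K where "K = complement_in W S"
  define Triv where "Triv = trivial_flexes V p"
  have W: "subspace W" and S: "subspace S" and Triv: "subspace Triv"
    by (simp_all add: W_def S_def Triv_def subspace_families subspace_trivial_flexes)
  then have K: "subspace K" by (simp add: K_def subspace_complement_in)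
  have "edge_row p ` E \<subseteq> W"
    using graph by (auto simp: W_def simple_graph_def intro!: edge_row_in_families)
  then have SW: "S \<subseteq> W" unfolding S_def by (rule span_minimal[OF _ W])
  have "?f ` edge_row p ` E \<subseteq> edge_row p ` E" by (auto simp: rho_v_edge_row \<sigma>_edge)
  then have fS: "?f ` S \<subseteq> S"
    unfolding S_def by (metis linear_span_image[OF linear_rho_v] span_mono)
  have TrivK: "Triv \<subseteq> K"
  proof
    fix x assume x: "x \<in> Triv"
    have "orthogonal r x" if "r \<in> edge_row p ` E" for r
      using that x edgeE edge_row_orthogonal_trivial_flex[of _ _ V x p] unfolding Triv_def
      by (metis (no_types, lifting) empty_subsetI image_iff insert_subset)
    then have "orthogonal s x" if "s \<in> S" for s
      using that orthogonal_to_span[of s "edge_row p ` E" x] unfolding S_def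
      by (metis orthogonal_commute)
    then show "x \<in> K"
      using x trivial_flexes_subset by (auto simp: K_def complement_in_def W_def Triv_def)
  qed
  have fTriv: "?f ` Triv \<subseteq> Triv" unfolding Triv_def by (rule rho_v_trivial_flexes)
  have isoW: "isometric_on W ?f" unfolding W_def by (rule isometric_on_rho_v)
  have isoK: "isometric_on K ?f"
    unfolding K_def by (rule isometric_on_complement[OF isoW S SW fS])
  have isoR: "isometric_on (complement_in K Triv) ?f"
    by (rule isometric_on_complement[OF isoK Triv TrivK fTriv])
  have "trace_on W ?f = trace_on S ?f + trace_on Triv ?f + trace_on (complement_in K Triv) ?f"
    using trace_on_complement[OF isoW W S SW fS] trace_on_complement[OF isoK K Triv TrivK fTriv]
    by (simp add: K_def)
  then have "trace_on (complement_in K Triv) ?f =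
      trace_sp T * real (card (unmoved_vertices V \<sigma>)) - real (card (unmoved_edges E \<sigma>))
        - trace_rig V p \<sigma> T"
    by (simp add: W_def S_def Triv_def trace_families trace_edge_rows[OF rows] trace_rig_def)
  moreover have "\<bar>trace_on (complement_in K Triv) ?f\<bar> \<le> real (dim (complement_in K Triv))"
    by (rule abs_trace_on_isometric_le_dim[OF isoR subspace_complement_in[OF K]])
  moreover have "real (dim (complement_in K Triv)) =
      real (CARD('d) * card V) - real (card E) - real (CARD('d) * (CARD('d) + 1)) / 2"
  proof -
    have "dim S = card E"
      unfolding S_def using rows by (simp add: dim_eq_card_independent card_image)
    moreover have "dim W = CARD('d) * card V" unfolding W_def by (rule dim_families)
    moreover have "real (dim Triv) = real (CARD('d) * (CARD('d) + 1)) / 2"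
      unfolding Triv_def by (rule dim_trivial_flexes[OF det])
    moreover have "dim K + dim S = dim W" unfolding K_def by (rule dim_complement_in[OF W S SW])
    moreover have "dim (complement_in K Triv) + dim Triv = dim K"
      by (rule dim_complement_in[OF K Triv TrivK])
    ultimately show ?thesis by linarith
  qed
  ultimately show ?thesis by simp
qed

end

section \<open>Reflections of the plane\<close>

lemma rho_sp_reflection:
  fixes T :: "real^'d \<Rightarrow> real^'d"
  assumes "\<And>x. T x = x - (2 * (a \<bullet> x - c) / (a \<bullet> a)) *\<^sub>R a"
  shows "rho_sp T x = x - (2 * (a \<bullet> x) / (a \<bullet> a)) *\<^sub>R a"
  by (simp add: rho_sp_def assms field_simps diff_divide_distrib scaleR_diff_left)

lemma trace_sp_reflection:
  fixes T :: "real^'d \<Rightarrow> real^'d"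
  assumes "a \<noteq> 0" "\<And>x. T x = x - (2 * (a \<bullet> x - c) / (a \<bullet> a)) *\<^sub>R a"
  shows "trace_sp T = real CARD('d) - 2"
proof -
  have "trace_sp T = (\<Sum>k\<in>UNIV. 1 - 2 / (a \<bullet> a) * (a $ k * a $ k))"
    unfolding trace_sp_def trace_def
    by (intro sum.cong refl) (simp add: matrix_def rho_sp_reflection[OF assms(2)] inner_axis)
  also have "\<dots> = real CARD('d) - 2 / (a \<bullet> a) * (\<Sum>k\<in>UNIV. a $ k * a $ k)"
    by (simp add: sum_subtractf sum_distrib_left)
  also have "(\<Sum>k\<in>UNIV. a $ k * a $ k) = a \<bullet> a" by (simp add: inner_vec_def)
  finally show ?thesis using assms(1) by simp
qed

text \<open>The matrix \<open>J\<close> of a rotation by a right angle spans the skew matrices of the plane. The third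
  property expands \<open>J *v x\<close> in the orthogonal basis \<open>a\<close>, \<open>J *v a\<close>; the second coefficient is
  \<open>(J *v a) \<bullet> (J *v x) = a \<bullet> x\<close>.\<close>
lemma plane_quarter_turn:
  assumes "CARD('d) = 2"
  obtains J :: "real^'d^'d" where "J \<in> skew_matrices"
    and "\<And>x. J *v (J *v x) = - x"
    and "\<And>a x. (a \<bullet> a) *\<^sub>R (J *v x) = (a \<bullet> (J *v x)) *\<^sub>R a + (a \<bullet> x) *\<^sub>R (J *v a)"
    and "\<And>A. A \<in> skew_matrices \<Longrightarrow> \<exists>t. A = t *\<^sub>R J"
proof -
  obtain k l :: 'd where kl: "k \<noteq> l" "UNIV = {k, l}"
    using assms card_2_iff[of "UNIV :: 'd set"] by auto
  define J :: "real^'d^'d" where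
    "J = (\<chi> i j. if i = k \<and> j = l then -1 else if i = l \<and> j = k then 1 else 0)"
  have all: "(\<forall>i. P i) \<longleftrightarrow> P k \<and> P l" for P
    using kl(2) by (metis UNIV_I empty_iff insert_iff)
  have sum: "(\<Sum>i\<in>UNIV. f i) = f k + f l" for f :: "'d \<Rightarrow> real"
    by (subst kl(2)) (simp add: kl(1))
  have J: "(J *v x) $ k = - x $ l" "(J *v x) $ l = x $ k" for x
    using kl(1) by (simp_all add: J_def matrix_vector_mult_def sum)
  show thesis
  proof (rule that)
    show "J \<in> skew_matrices"
      using kl(1) by (simp add: skew_matrices_def transpose_def vec_eq_iff J_def all)
    show "J *v (J *v x) = - x" for x
      by (simp add: vec_eq_iff all J)
    show "(a \<bullet> a) *\<^sub>R (J *v x) = (a \<bullet> (J *v x)) *\<^sub>R a + (a \<bullet> x) *\<^sub>R (J *v a)" for a x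
      by (simp add: vec_eq_iff all J inner_vec_def sum) (simp add: algebra_simps)
    show "\<exists>t. A = t *\<^sub>R J" if "A \<in> skew_matrices" for A
    proof -
      have skew: "A $ i $ j = - (A $ j $ i)" for i j
      proof -
        have "transpose A $ j $ i = (- A) $ j $ i" using that by (simp add: skew_matrices_def)
        then show ?thesis by (simp add: transpose_def)
      qed
      have "A $ k $ k = 0" "A $ l $ l = 0" using skew[of k k] skew[of l l] by linarith+
      then have "A = (A $ l $ k) *\<^sub>R J"
        unfolding vec_eq_iff all using kl(1) skew[of k l] by (simp add: J_def)
      then show ?thesis by blast
    qed
  qed
qed

text \<open>A nonzero skew matrix of the plane is a nonzero multiple of a rotation, hence injective, so two distinct
  points already detect every infinitesimal rigid motion.\<close>
lemma flex_determining_plane: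
  fixes p :: "'v \<Rightarrow> real^'d"
  assumes d: "CARD('d) = 2" and uv: "u \<in> V" "v \<in> V" "p u \<noteq> p v"
  shows "flex_determining V p"
  unfolding flex_determining_def
proof (intro ballI allI impI)
  fix A :: "real^'d^'d" and b :: "real^'d"
  assume A: "A \<in> skew_matrices" and z: "\<forall>i\<in>V. A *v p i + b = 0"
  obtain J :: "real^'d^'d" where "J \<in> skew_matrices" and JJ: "\<And>x. J *v (J *v x) = - x"
    and "\<And>A. A \<in> skew_matrices \<Longrightarrow> \<exists>t. A = t *\<^sub>R J"
    using plane_quarter_turn[OF d] by metis
  then obtain t where t: "A = t *\<^sub>R J" using A by blast
  have "A *v (p u - p v) = (A *v p u + b) - (A *v p v + b)"
    by (simp add: matrix_vector_mult_diff_distrib)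
  also have "\<dots> = 0" using z uv by simp
  finally have "t *\<^sub>R (J *v (p u - p v)) = 0"
    by (simp add: t scaleR_matrix_vector_assoc)
  moreover have "J *v (p u - p v) \<noteq> 0"
  proof
    assume "J *v (p u - p v) = 0"
    then have "- (p u - p v) = 0" by (metis JJ matrix_vector_mult_0_right)
    then show False using uv(3) by simp
  qed
  ultimately have "A = 0" by (simp add: t)
  then show "A = 0 \<and> b = 0" using z uv(1) by auto
qed

context framework_symmetry
begin

text \<open>With \<open>q\<close> on the mirror line, the translations along the normal \<open>a\<close> and along the mirror direction
  \<open>J *v a\<close> and the rotation about \<open>q\<close> are eigenvectors, with eigenvalues \<open>-1\<close>, \<open>1\<close> and \<open>-1\<close>: a
  reflection reverses the sense of a rotation about a point of its mirror.\<close>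
lemma trace_rig_plane_reflection:
  assumes d: "CARD('d) = 2" and refl: "hyperplane_reflection T" and det: "flex_determining V p"
  shows "trace_rig V p \<sigma> T = - 1"
proof -
  obtain a c where a: "a \<noteq> 0"
    and T: "\<And>x. T x = x - (2 * (a \<bullet> x - c) / (a \<bullet> a)) *\<^sub>R a"
    using refl unfolding hyperplane_reflection_def by blast
  obtain J :: "real^'d^'d" where J: "J \<in> skew_matrices"
    and JJ: "\<And>x. J *v (J *v x) = - x"
    and expand: "\<And>a x. (a \<bullet> a) *\<^sub>R (J *v x) = (a \<bullet> (J *v x)) *\<^sub>R a + (a \<bullet> x) *\<^sub>R (J *v a)"
    using plane_quarter_turn[OF d] by metis
  have J0: "J *v x \<noteq> 0" if "x \<noteq> 0" for x
    using JJ[of x] that by auto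
  note R = rho_sp_reflection[OF T]
  \<comment> \<open>the foot of the perpendicular from the origin to the mirror, which is fixed by \<open>T\<close>\<close>
  define q where "q = (c / (a \<bullet> a)) *\<^sub>R a"
  have aq: "a \<bullet> q = c" using a by (simp add: q_def)
  have q: "T q = q" by (simp add: T aq)
  have Ja: "a \<bullet> (J *v a) = 0" using skew_inner_self[OF J] by (simp add: inner_commute)
  let ?F = "rigid_flex V p q"
  define B :: "((real^'d^'d) \<times> (real^'d)) set" where "B = {(0, a), (0, J *v a), (J, 0)}"
  have "J \<noteq> 0" using J0[OF a] by auto
  have "pairwise orthogonal B"
    using Ja by (auto simp: B_def pairwise_def orthogonal_def inner_prod_def inner_commute)
  moreover have "0 \<notin> B" using a J0 \<open>J \<noteq> 0\<close> by (auto simp: B_def zero_prod_def)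
  ultimately have indB: "independent B" by (rule pairwise_orthogonal_independent)
  have "a \<noteq> J *v a" using Ja a by (metis inner_eq_zero_iff)
  then have cardB: "card B = 3" using \<open>J \<noteq> 0\<close> by (simp add: B_def)
  have subB: "B \<subseteq> skew_matrices \<times> UNIV"
    using J subspace_0[OF subspace_skew_matrices] by (auto simp: B_def)
  have inj: "inj_on ?F (skew_matrices \<times> UNIV)" by (rule inj_on_rigid_flex[OF det])
  then have injB: "inj_on ?F B" by (rule inj_on_subset[OF _ subB])
  have "inj_on ?F (span B)"
    using subB by (intro inj_on_subset[OF inj] span_minimal subspace_Times subspace_skew_matrices) auto
  then have ind: "independent (?F ` B)"
    using indB linear_rigid_flex by (intro linear_independent_injective_image) auto
  have sub: "?F ` B \<subseteq> trivial_flexes V p"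
    using subB trivial_flexes_eq_image[of V p q] by blast
  have "dim (trivial_flexes V p) = 3"
    using dim_trivial_flexes[OF det] d by simp
  then have "trivial_flexes V p \<subseteq> span (?F ` B)"
    using sub ind cardB by (intro card_ge_dim_independent) (simp_all add: card_image[OF injB])
  then have span: "span (?F ` B) = trivial_flexes V p"
    using sub by (simp add: span_minimal subspace_trivial_flexes subset_antisym)
  have F_minus: "?F (- x) = - ?F x" for x
    by (rule linear_neg[OF linear_rigid_flex])
  have Ra: "rho_sp T a = - a" using a by (simp add: R scaleR_2)
  have RJa: "rho_sp T (J *v a) = J *v a" by (simp add: R Ja)
  \<comment> \<open>conjugation by a reflection changes the sign of \<open>J\<close>\<close>
  have anti: "(- J) *v rho_sp T x = rho_sp T (J *v x)" for x
  proof -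
    define \<alpha> \<beta> where "\<alpha> = a \<bullet> (J *v x) / (a \<bullet> a)" and "\<beta> = a \<bullet> x / (a \<bullet> a)"
    have "(1 / (a \<bullet> a)) *\<^sub>R (a \<bullet> a) *\<^sub>R (J *v x) = \<alpha> *\<^sub>R a + \<beta> *\<^sub>R (J *v a)"
      unfolding expand by (simp add: \<alpha>_def \<beta>_def scaleR_add_right)
    then have Jx: "J *v x = \<alpha> *\<^sub>R a + \<beta> *\<^sub>R (J *v a)" using a by simp
    have Rx: "rho_sp T x = x - (2 * \<beta>) *\<^sub>R a" by (simp add: R \<beta>_def)
    have "(- J) *v rho_sp T x = - (J *v rho_sp T x)"
      by (simp add: matrix_vector_mult_def vec_eq_iff sum_negf)
    also have "\<dots> = - \<alpha> *\<^sub>R a + \<beta> *\<^sub>R (J *v a)"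
      by (simp add: matrix_vector_mult_diff_distrib matrix_vector_mult_scaleR Rx Jx vec_eq_iff algebra_simps)
    also have "\<dots> = J *v x - (2 * \<alpha>) *\<^sub>R a" by (simp add: Jx vec_eq_iff algebra_simps)
    also have "\<dots> = rho_sp T (J *v x)" by (simp add: R \<alpha>_def)
    finally show ?thesis .
  qed
  have "rho_v V \<sigma> T (?F (0, a)) = ?F (0, rho_sp T a)"
    using rho_v_rigid_flex[of 0 0 q a] by (simp add: q linear_0[OF linear_rho_sp])
  also have "(0 :: real^'d^'d, rho_sp T a) = - (0, a)" by (simp add: Ra)
  finally have e1: "rho_v V \<sigma> T (?F (0, a)) = - ?F (0, a)" by (simp only: F_minus)
  have e2: "rho_v V \<sigma> T (?F (0, J *v a)) = ?F (0, J *v a)"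
    using rho_v_rigid_flex[of 0 0 q "J *v a"] by (simp add: q linear_0[OF linear_rho_sp] RJa)
  have "rho_v V \<sigma> T (?F (J, 0)) = ?F (- J, 0)"
    using rho_v_rigid_flex[OF anti, of q 0] by (simp add: q linear_0[OF linear_rho_sp])
  also have "(- J, 0) = - (J, 0 :: real^'d)" by simp
  finally have e3: "rho_v V \<sigma> T (?F (J, 0)) = - ?F (J, 0)" by (simp only: F_minus)
  define l where "l = (\<lambda>w. if w = ?F (0, J *v a) then 1 else - 1 :: real)"
  have ne: "?F (0, a) \<noteq> ?F (0, J *v a)" "?F (J, 0) \<noteq> ?F (0, J *v a)"
    using inj_on_eq_iff[OF injB] \<open>a \<noteq> J *v a\<close> \<open>J \<noteq> 0\<close> by (auto simp: B_def)
  have "trace_rig V p \<sigma> T = (\<Sum>w\<in>?F ` B. l w)"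
    unfolding trace_rig_def
  proof (rule trace_on_eigenbasis[OF linear_rho_v ind span])
    fix w assume "w \<in> ?F ` B"
    then show "rho_v V \<sigma> T w = l w *\<^sub>R w"
      using e1 e2 e3 ne by (auto simp: B_def l_def)
  qed
  also have "\<dots> = (\<Sum>x\<in>B. l (?F x))" by (rule sum.reindex[OF injB, unfolded o_def])
  also have "\<dots> = - 1"
    using ne \<open>a \<noteq> J *v a\<close> \<open>J \<noteq> 0\<close> by (simp add: B_def l_def)
  finally show ?thesis .
qed

end

section \<open>The symmetric isostatic count\<close>

theorem theorem5p1:
  fixes E :: "'v::finite set set" and p :: "'v \<Rightarrow> real^'d"
  assumes "proper_framework E p" and "isostatic E p"
  shows "(\<forall>V\<^sub>X E\<^sub>X \<sigma> T.
            proper_subframework E p V\<^sub>X E\<^sub>X \<and> spatial_symmetry V\<^sub>X E\<^sub>X p \<sigma> T \<longrightarrow>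
            \<bar>trace_sp T * real (card (unmoved_vertices V\<^sub>X \<sigma>)) - real (card (unmoved_edges E\<^sub>X \<sigma>))
               - trace_rig V\<^sub>X p \<sigma> T\<bar>
            \<le> real (CARD('d) * card V\<^sub>X) - real (card E\<^sub>X) - real (CARD('d) * (CARD('d) + 1)) / 2) \<and>
         (CARD('d) = 2 \<longrightarrow>
          (\<forall>V\<^sub>X E\<^sub>X \<sigma> T.
            subframework E V\<^sub>X E\<^sub>X \<and> reflection_symmetry V\<^sub>X E\<^sub>X p \<sigma> T \<longrightarrow>
            \<bar>- real (card (unmoved_edges E\<^sub>X \<sigma>)) + 1\<bar>
            \<le> 2 * real (card V\<^sub>X) - real (card E\<^sub>X) - 3))"
proof -
  have rows: "inj_on (edge_row p) E'" "independent (edge_row p ` E')" if "E' \<subseteq> E" for E'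
    using isostatic_rows[OF assms(2)] inj_on_subset independent_mono image_mono that by metis+
  show ?thesis
  proof (intro conjI allI impI; elim conjE)
    fix V\<^sub>X E\<^sub>X \<sigma> T
    assume X: "proper_subframework E p V\<^sub>X E\<^sub>X" and g: "spatial_symmetry V\<^sub>X E\<^sub>X p \<sigma> T"
    interpret framework_symmetry V\<^sub>X E\<^sub>X p \<sigma> T
      using X g by unfold_locales (auto simp: proper_subframework_def subframework_def)
    show "\<bar>trace_sp T * real (card (unmoved_vertices V\<^sub>X \<sigma>)) - real (card (unmoved_edges E\<^sub>X \<sigma>))
               - trace_rig V\<^sub>X p \<sigma> T\<bar>
            \<le> real (CARD('d) * card V\<^sub>X) - real (card E\<^sub>X) - real (CARD('d) * (CARD('d) + 1)) / 2"
      using X by (intro symmetric_count rows flex_determining_if_not_in_hyperplane)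
        (auto simp: proper_subframework_def subframework_def)
  next
    fix V\<^sub>X E\<^sub>X \<sigma> T
    assume d: "CARD('d) = 2" and X: "subframework E V\<^sub>X E\<^sub>X"
      and g: "reflection_symmetry V\<^sub>X E\<^sub>X p \<sigma> T"
    interpret framework_symmetry V\<^sub>X E\<^sub>X p \<sigma> T
      using X g by unfold_locales (auto simp: subframework_def reflection_symmetry_def)
    obtain e where "e \<in> E\<^sub>X" using X by (auto simp: subframework_def)
    then obtain u v where "u \<noteq> v" "u \<in> V\<^sub>X" "v \<in> V\<^sub>X" by (rule edgeE)
    moreover have "inj p" using assms(1) by (simp add: proper_framework_def)
    ultimately have det: "flex_determining V\<^sub>X p"
      using d by (intro flex_determining_plane[of u V\<^sub>X v]) (auto dest: injD)
    have refl: "hyperplane_reflection T" using g by (simp add: reflection_symmetry_def)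
    then have "trace_sp T = 0"
      unfolding hyperplane_reflection_def using d trace_sp_reflection[of _ T] by auto
    moreover have "trace_rig V\<^sub>X p \<sigma> T = - 1"
      by (rule trace_rig_plane_reflection[OF d refl det])
    moreover have "E\<^sub>X \<subseteq> E" using X by (simp add: subframework_def)
    ultimately show "\<bar>- real (card (unmoved_edges E\<^sub>X \<sigma>)) + 1\<bar>
            \<le> 2 * real (card V\<^sub>X) - real (card E\<^sub>X) - 3"
      using symmetric_count[OF rows det] d by simp
  qed
qed

end
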